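(* Let $f,g,\phi$ satisfy the composite smoothness assumption and the bounded domain assumption for some $\Omega\ge0$, and let the saddle-subdifferential operator $M=(\nabla_u\phi+\partial f,\,-\nabla_v\phi+\partial g)$ of the problem $\min_{u}\max_{v}\{f(u)+\phi(u,v)-g(v)\}$ satisfy the strong MVI condition for some $\mu\ge0$. Then, for every $k\ge1$, every $\tau\in\big(0,\frac{1}{L+\hat L}\big)$ and every $x_*\in S_*^\mu(M)$, the sequence $\{x_k\}$ of the SA-MGDA method with a finite number $J$ of inner iterations satisfies $$D_h(x_*,x_k)\le\left(1+\frac{2\tau\mu}{1+\tau L}\right)^{-k}D_h(x_*,x_0)+\sum_{i=1}^k\left(1+\frac{2\tau\mu}{1+\tau L}\right)^{-i+1}\frac{3\Omega^2\left(\frac1\tau+L\right)}{2}\exp\left(-\frac{\frac1\tau-2L_{vv}}{2\left(\frac1\tau+2L_{vv}\right)}J\right).$$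
   Context: Let $d=d_u+d_v$, $x=(u,v)\in\mathbb{R}^{d_u}\times\mathbb{R}^{d_v}=\mathbb{R}^d$ with Euclidean inner product and norm. Composite smoothness assumption: $f:\mathbb{R}^{d_u}\to(-\infty,\infty]$ and $g:\mathbb{R}^{d_v}\to(-\infty,\infty]$ are closed, proper and convex; $\phi:\mathbb{R}^d\to\mathbb{R}$ is continuously differentiable and there are $L_{uu},L_{uv},L_{vu},L_{vv}>0$ with $\|\nabla_u\phi(u,v)-\nabla_u\phi(\bar u,\bar v)\|\le L_{uu}\|u-\bar u\|+L_{uv}\|v-\bar v\|$ and $\|\nabla_v\phi(u,v)-\nabla_v\phi(\bar u,\bar v)\|\le L_{vu}\|u-\bar u\|+L_{vv}\|v-\bar v\|$ for all $u,\bar u,v,\bar v$. $L>0$ denotes a Lipschitz constant of $\nabla\phi$ (equivalently of $(\nabla_u\phi,-\nabla_v\phi)$) on $\mathbb{R}^d$, and $\hat L=\max\{L_{uu},L_{vv}\}$. Bounded domain assumption: $\|x-y\|\le\Omega$ for all $x,y\in\operatorname{dom}f\times\operatorname{dom}g$. $\operatorname{gra}M=\{(x,w):w\in Mx\}$; $X_*(M)=\{x_*:0\in Mx_*\}$ (assumed nonempty). Strong MVI condition with $\mu\ge0$: there exists $x_*\in X_*(M)$ such that $\langle x-x_*,w\rangle\ge\mu\|x-x_*\|^2$ for all $(x,w)\in\operatorname{gra}M$. $S_*^\mu(M)$ is the set of all $x_*\in X_*(M)$ with this property. Let $h(u,v)=\frac{1}{2\tau}(\|u\|^2+\|v\|^2)-\phi(u,v)$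 and $D_h(x,y)=h(x)-h(y)-\langle\nabla h(y),x-y\rangle$. SA-MGDA with finite $J\ge1$: let $\eta=\frac{\tau}{1+2L_{vv}\tau}$ and $\operatorname{prox}_\psi=(I+\partial\psi)^{-1}$. From an initial point $x_0=(u_0,v_0)$, for $k=0,1,\dots$: set $u_{k+1}=\operatorname{prox}_{\tau f}[u_k-\tau\nabla_u\phi(u_k,v_k)]$ and $v_{k,0}=v_k$; for $j=0,\dots,J-1$ set $v_{k,j+1}=\operatorname{prox}_{\eta g}\big[\frac\eta\tau(v_k-\tau\nabla_v\phi(u_k,v_k))+2\eta L_{vv}\big(v_{k,j}+\frac1{L_{vv}}\nabla_v\phi(u_{k+1},v_{k,j})\big)\big]$; then $v_{k+1}=v_{k,J}$ and $x_{k+1}=(u_{k+1},v_{k+1})$. *)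

theory Defs
  imports "HOL-Analysis.Analysis"
begin

definition effective_domain :: "('a \<Rightarrow> ereal) \<Rightarrow> 'a set" where
  "effective_domain \<psi> = {x. \<psi> x < \<infinity>}"

definition epi :: "('a \<Rightarrow> ereal) \<Rightarrow> ('a \<times> real) set" where
  "epi \<psi> = {(x, r). \<psi> x \<le> ereal r}"

text \<open>Closedness (lower semicontinuity) and convexity are stated through the epigraph, which
  avoids arithmetic with infinite values.\<close>

definition closed_proper_convex :: "('a::euclidean_space \<Rightarrow> ereal) \<Rightarrow> bool" where
  "closed_proper_convex \<psi> \<longleftrightarrow>
     closed (epi \<psi>) \<and> convex (epi \<psi>) \<and>
     (\<forall>x. \<psi> x \<noteq> -\<infinity>) \<and> effective_domain \<psi> \<noteq> {}"

text \<open>For proper \<open>\<psi>\<close> this set is automatically empty outside the effective domain.\<close>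

definition subdifferential :: "('a::euclidean_space \<Rightarrow> ereal) \<Rightarrow> 'a \<Rightarrow> 'a set" where
  "subdifferential \<psi> x = {w. \<forall>y. \<psi> x + ereal (w \<bullet> (y - x)) \<le> \<psi> y}"

text \<open>The value of \<open>(I + \<partial>\<psi>)\<^sup>-\<^sup>1\<close> at \<open>y\<close>; it is single-valued with full domain for closed proper
  convex \<open>\<psi>\<close>.\<close>

definition prox :: "('a::euclidean_space \<Rightarrow> ereal) \<Rightarrow> 'a \<Rightarrow> 'a" where
  "prox \<psi> y = (THE p. y \<in> (\<lambda>w. p + w) ` subdifferential \<psi> p)"

definition grad :: "('a::euclidean_space \<Rightarrow> real) \<Rightarrow> 'a \<Rightarrow> 'a" where
  "grad F x = (THE D. GDERIV F x :> D)"

definition grad_u :: "('u::euclidean_space \<times> 'v::euclidean_space \<Rightarrow> real) \<Rightarrow> 'u \<times> 'v \<Rightarrow> 'u" where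
  "grad_u \<phi> x = grad (\<lambda>u. \<phi> (u, snd x)) (fst x)"

definition grad_v :: "('u::euclidean_space \<times> 'v::euclidean_space \<Rightarrow> real) \<Rightarrow> 'u \<times> 'v \<Rightarrow> 'v" where
  "grad_v \<phi> x = grad (\<lambda>v. \<phi> (fst x, v)) (snd x)"

definition continuously_differentiable :: "('a::euclidean_space \<Rightarrow> real) \<Rightarrow> bool" where
  "continuously_differentiable F \<longleftrightarrow>
     (\<forall>x. F differentiable (at x)) \<and> continuous_on UNIV (grad F)"

definition composite_smoothness ::
  "('u::euclidean_space \<Rightarrow> ereal) \<Rightarrow> ('v::euclidean_space \<Rightarrow> ereal) \<Rightarrow> ('u \<times> 'v \<Rightarrow> real) \<Rightarrow>
   real \<Rightarrow> real \<Rightarrow> real \<Rightarrow> real \<Rightarrow> bool" where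
  "composite_smoothness f g \<phi> Luu Luv Lvu Lvv \<longleftrightarrow>
     closed_proper_convex f \<and> closed_proper_convex g \<and> continuously_differentiable \<phi> \<and>
     Luu > 0 \<and> Luv > 0 \<and> Lvu > 0 \<and> Lvv > 0 \<and>
     (\<forall>u u' v v'.
        norm (grad_u \<phi> (u, v) - grad_u \<phi> (u', v')) \<le> Luu * norm (u - u') + Luv * norm (v - v') \<and>
        norm (grad_v \<phi> (u, v) - grad_v \<phi> (u', v')) \<le> Lvu * norm (u - u') + Lvv * norm (v - v'))"

definition bounded_domain ::
  "('u::euclidean_space \<Rightarrow> ereal) \<Rightarrow> ('v::euclidean_space \<Rightarrow> ereal) \<Rightarrow> real \<Rightarrow> bool" where
  "bounded_domain f g \<Omega> \<longleftrightarrow>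
     (\<forall>x \<in> effective_domain f \<times> effective_domain g.
      \<forall>y \<in> effective_domain f \<times> effective_domain g. norm (x - y) \<le> \<Omega>)"

definition gra :: "('a \<Rightarrow> 'a set) \<Rightarrow> ('a \<times> 'a) set" where
  "gra M = {(x, w). w \<in> M x}"

definition zeros :: "('a::zero \<Rightarrow> 'a set) \<Rightarrow> 'a set" where
  "zeros M = {x. 0 \<in> M x}"

definition strong_MVI_solutions :: "real \<Rightarrow> ('a::euclidean_space \<Rightarrow> 'a set) \<Rightarrow> 'a set" where
  "strong_MVI_solutions \<mu> M =
     {xs \<in> zeros M. \<forall>(x, w) \<in> gra M. (x - xs) \<bullet> w \<ge> \<mu> * (norm (x - xs))\<^sup>2}"

definition strong_MVI :: "real \<Rightarrow> ('a::euclidean_space \<Rightarrow> 'a set) \<Rightarrow> bool" where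
  "strong_MVI \<mu> M \<longleftrightarrow>
     (\<exists>xs \<in> zeros M. \<forall>(x, w) \<in> gra M. (x - xs) \<bullet> w \<ge> \<mu> * (norm (x - xs))\<^sup>2)"

definition saddle_operator ::
  "('u::euclidean_space \<Rightarrow> ereal) \<Rightarrow> ('v::euclidean_space \<Rightarrow> ereal) \<Rightarrow> ('u \<times> 'v \<Rightarrow> real) \<Rightarrow>
   'u \<times> 'v \<Rightarrow> ('u \<times> 'v) set" where
  "saddle_operator f g \<phi> x =
     (\<lambda>a. grad_u \<phi> x + a) ` subdifferential f (fst x) \<times>
     (\<lambda>b. - grad_v \<phi> x + b) ` subdifferential g (snd x)"

definition bregman :: "('a::euclidean_space \<Rightarrow> real) \<Rightarrow> 'a \<Rightarrow> 'a \<Rightarrow> real" where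
  "bregman h x y = h x - h y - grad h y \<bullet> (x - y)"

definition h_fun ::
  "real \<Rightarrow> ('u::euclidean_space \<times> 'v::euclidean_space \<Rightarrow> real) \<Rightarrow> 'u \<times> 'v \<Rightarrow> real" where
  "h_fun \<tau> \<phi> x = 1 / (2 * \<tau>) * ((norm (fst x))\<^sup>2 + (norm (snd x))\<^sup>2) - \<phi> x"

text \<open>One inner step \<open>w = v\<^bsub>k,j\<^esub> \<mapsto> v\<^bsub>k,j+1\<^esub>\<close>; \<open>xk\<close> is \<open>(u\<^sub>k, v\<^sub>k)\<close> and \<open>u'\<close> is \<open>u\<^bsub>k+1\<^esub>\<close>.\<close>

definition samgda_inner ::
  "('v::euclidean_space \<Rightarrow> ereal) \<Rightarrow> ('u::euclidean_space \<times> 'v \<Rightarrow> real) \<Rightarrow> real \<Rightarrow> real \<Rightarrow>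
   'u \<times> 'v \<Rightarrow> 'u \<Rightarrow> 'v \<Rightarrow> 'v" where
  "samgda_inner g \<phi> Lvv \<tau> xk u' w =
     (let \<eta> = \<tau> / (1 + 2 * Lvv * \<tau>) in
      prox (\<lambda>v. ereal \<eta> * g v)
        ((\<eta> / \<tau>) *\<^sub>R (snd xk - \<tau> *\<^sub>R grad_v \<phi> xk)
         + (2 * \<eta> * Lvv) *\<^sub>R (w + (1 / Lvv) *\<^sub>R grad_v \<phi> (u', w))))"

definition samgda_step ::
  "('u::euclidean_space \<Rightarrow> ereal) \<Rightarrow> ('v::euclidean_space \<Rightarrow> ereal) \<Rightarrow> ('u \<times> 'v \<Rightarrow> real) \<Rightarrow>
   real \<Rightarrow> real \<Rightarrow> nat \<Rightarrow> 'u \<times> 'v \<Rightarrow> 'u \<times> 'v" where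
  "samgda_step f g \<phi> Lvv \<tau> J xk =
     (let u' = prox (\<lambda>u. ereal \<tau> * f u) (fst xk - \<tau> *\<^sub>R grad_u \<phi> xk)
      in (u', (samgda_inner g \<phi> Lvv \<tau> xk u' ^^ J) (snd xk)))"

primrec samgda ::
  "('u::euclidean_space \<Rightarrow> ereal) \<Rightarrow> ('v::euclidean_space \<Rightarrow> ereal) \<Rightarrow> ('u \<times> 'v \<Rightarrow> real) \<Rightarrow>
   real \<Rightarrow> real \<Rightarrow> nat \<Rightarrow> 'u \<times> 'v \<Rightarrow> nat \<Rightarrow> 'u \<times> 'v" where
  "samgda f g \<phi> Lvv \<tau> J x0 0 = x0"
| "samgda f g \<phi> Lvv \<tau> J x0 (Suc k) = samgda_step f g \<phi> Lvv \<tau> J (samgda f g \<phi> Lvv \<tau> J x0 k)"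

end

theory Submission
  imports Defs
begin

text \<open>
  Write \<open>c = (1/\<tau> - 2 Lvv) / (2 (1/\<tau> + 2 Lvv))\<close>, \<open>K = 1/\<tau> + L\<close> and
  \<open>\<theta> = 1 + 2 \<tau> \<mu> / (1 + \<tau> L)\<close>. If the inner problem were solved exactly, that is, if \<open>v\<close> were a
  fixed point of the inner map, then the optimality conditions of the two proximal maps would say
  that the new point \<open>p\<close> satisfies \<open>\<nabla>h(x) - \<nabla>h(p) \<in> M p\<close>
  (\<open>exact_step_is_bregman_proximal_point\<close>). This is a Bregman proximal point step, and the strong
  Minty inequality at \<open>x\<^sub>*\<close> gives \<open>\<theta> D\<^sub>h(x\<^sub>*, p) \<le> D\<^sub>h(x\<^sub>*, x)\<close>
  (\<open>bregman_proximal_point_contraction\<close>): \<open>D\<^sub>h\<close> is nonnegative because \<open>1/\<tau> > L\<close>, and it is at most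
  \<open>K/2\<close> times the squared distance because \<open>\<nabla>h\<close> is \<open>K\<close>-Lipschitz.

  The actual step runs only \<open>J\<close> rounds of the inner map, whose Lipschitz constant is
  \<open>1 - 2 c\<close>. If its result has distance \<open>e\<close> from \<open>p\<close>, the three-point identity shows that
  \<open>D\<^sub>h(x\<^sub>*, \<cdot>)\<close> grows by at most \<open>K (e\<^sup>2 / 2 + e \<Omega>)\<close>, and \<open>e \<le> \<Omega> exp (- c J) \<le> \<Omega>\<close> turns this into the
  error term \<open>(3/2) K \<Omega>\<^sup>2 exp (- c J)\<close>.

  Two points need care. The initial point may lie outside the domain, so that the diameter \<open>\<Omega>\<close>
  bounds the inner error only after one round; the remaining \<open>J - 1\<close> contractions still suffice for
  \<open>J \<ge> 2\<close>, since \<open>(1 - 2 c) ^ (J - 1) \<le> exp (- 2 c (J - 1)) \<le> exp (- c J)\<close>. Moreover \<open>1/\<tau> > L + Lvv\<close>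
  does not imply \<open>1/\<tau> > 2 Lvv\<close>, so \<open>c\<close> may be nonpositive, and then the Lipschitz constant of
  the inner map gives no contraction. In both exceptional cases, \<open>J = 1\<close> and \<open>c \<le> 0\<close>, one has
  \<open>3 exp (- c J) \<ge> 1\<close> since always \<open>c < 1/2\<close>, and the error term already dominates \<open>D\<^sub>h \<le> K \<Omega>\<^sup>2 / 2\<close> on the domain
  (\<open>samgda_step_inexact_contraction\<close>). Unrolling the one-step estimate gives the theorem.
\<close>

section \<open>Gradients\<close>

lemma grad_eqI: "GDERIV F x :> D \<Longrightarrow> grad F x = D"
  unfolding grad_def
proof (rule the_equality)
  fix D' assume "GDERIV F x :> D" "GDERIV F x :> D'"
  then have "(\<lambda>h. h \<bullet> D) = (\<lambda>h. h \<bullet> D')"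
    unfolding gderiv_def by (rule has_derivative_unique)
  then show "D' = D"
    by (metis inner_commute vector_eq_ldot)
qed

text \<open>Existence of the gradient is the Riesz representation of the derivative.\<close>

lemma differentiable_has_grad:
  fixes F :: "'a::euclidean_space \<Rightarrow> real"
  assumes "F differentiable (at x)"
  shows "GDERIV F x :> grad F x"
proof -
  obtain F' where F': "(F has_derivative F') (at x)"
    using assms by (auto simp: differentiable_def)
  then have "linear F'"
    by (rule has_derivative_linear)
  then have "F' = (\<lambda>h. h \<bullet> adjoint F' 1)"
    using adjoint_works[of F' _ 1] by (simp add: fun_eq_iff)
  then have "GDERIV F x :> adjoint F' 1"
    using F' unfolding gderiv_def by simp
  then show ?thesis
    using grad_eqI by metis
qed

lemma grad_u_eq_fst_grad:
  assumes "\<phi> differentiable (at x)"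
  shows "grad_u \<phi> x = fst (grad \<phi> x)"
proof -
  have "(\<phi> has_derivative (\<lambda>h. h \<bullet> grad \<phi> x)) (at (fst x, snd x))"
    using differentiable_has_grad[OF assms] by (simp add: gderiv_def)
  moreover have "((\<lambda>u. (u, snd x)) has_derivative (\<lambda>h. (h, 0))) (at (fst x))"
    by (auto intro!: derivative_eq_intros)
  ultimately have "((\<lambda>u. \<phi> (u, snd x)) has_derivative (\<lambda>h. (h, 0) \<bullet> grad \<phi> x)) (at (fst x))"
    using has_derivative_compose[where g = \<phi>] by blast
  then show ?thesis
    unfolding grad_u_def by (intro grad_eqI) (simp add: gderiv_def inner_prod_def)
qed

lemma grad_v_eq_snd_grad:
  assumes "\<phi> differentiable (at x)"
  shows "grad_v \<phi> x = snd (grad \<phi> x)"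
proof -
  have "(\<phi> has_derivative (\<lambda>h. h \<bullet> grad \<phi> x)) (at (fst x, snd x))"
    using differentiable_has_grad[OF assms] by (simp add: gderiv_def)
  moreover have "((\<lambda>v. (fst x, v)) has_derivative (\<lambda>h. (0, h))) (at (snd x))"
    by (auto intro!: derivative_eq_intros)
  ultimately have "((\<lambda>v. \<phi> (fst x, v)) has_derivative (\<lambda>h. (0, h) \<bullet> grad \<phi> x)) (at (snd x))"
    using has_derivative_compose[where g = \<phi>] by blast
  then show ?thesis
    unfolding grad_v_def by (intro grad_eqI) (simp add: gderiv_def inner_prod_def)
qed

section \<open>Bregman distances\<close>

lemma bregman_three_point:
  "bregman h z x = bregman h z p + bregman h p x + (grad h x - grad h p) \<bullet> (p - z)"
  by (simp add: bregman_def algebra_simps)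

text \<open>Along the segment from \<open>y\<close> to \<open>x\<close> the Lipschitz condition bounds the growth of the
  derivative, so that \<open>\<plusminus>F\<close> minus its linearisation minus the quadratic bound is decreasing.\<close>

lemma descent_lemma:
  fixes F :: "'a::euclidean_space \<Rightarrow> real"
  assumes diff: "\<And>z. F differentiable (at z)" and lip: "L-lipschitz_on UNIV (grad F)"
  shows "\<bar>bregman F x y\<bar> \<le> L / 2 * (norm (x - y))\<^sup>2"
proof -
  define d where "d = x - y"
  have D: "((\<lambda>t. F (y + t *\<^sub>R d)) has_real_derivative (d \<bullet> grad F (y + t *\<^sub>R d))) (at t)" for t
  proof -
    have "(F has_derivative (\<lambda>h. h \<bullet> grad F (y + t *\<^sub>R d))) (at (y + t *\<^sub>R d))"
      using differentiable_has_grad[OF diff] by (simp add: gderiv_def)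
    moreover have "((\<lambda>t. y + t *\<^sub>R d) has_derivative (\<lambda>h. h *\<^sub>R d)) (at t)"
      by (auto intro!: derivative_eq_intros)
    ultimately have "((\<lambda>t. F (y + t *\<^sub>R d)) has_derivative
        (\<lambda>h. (h *\<^sub>R d) \<bullet> grad F (y + t *\<^sub>R d))) (at t)"
      using has_derivative_compose[where g = F] by blast
    then show ?thesis
      by (simp add: has_field_derivative_def mult.commute[of _ "d \<bullet> _"])
  qed
  have slope: "\<bar>d \<bullet> grad F (y + t *\<^sub>R d) - grad F y \<bullet> d\<bar> \<le> L * t * (norm d)\<^sup>2" if "t \<ge> 0" for t
  proof -
    have "\<bar>d \<bullet> grad F (y + t *\<^sub>R d) - grad F y \<bullet> d\<bar> = \<bar>d \<bullet> (grad F (y + t *\<^sub>R d) - grad F y)\<bar>"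
      by (simp add: inner_diff_right inner_commute)
    also have "\<dots> \<le> norm d * norm (grad F (y + t *\<^sub>R d) - grad F y)"
      by (rule Cauchy_Schwarz_ineq2)
    also have "\<dots> \<le> norm d * (L * (t * norm d))"
      using lipschitz_onD[OF lip, of "y + t *\<^sub>R d" y] that
      by (intro mult_left_mono) (auto simp: dist_norm)
    finally show ?thesis
      by (simp add: power2_eq_square ac_simps)
  qed
  have main: "\<sigma> * (F x - F y - grad F y \<bullet> d) \<le> L / 2 * (norm d)\<^sup>2" if "\<bar>\<sigma>\<bar> = 1" for \<sigma>
  proof -
    define s where "s t = \<sigma> * (F (y + t *\<^sub>R d) - t * (grad F y \<bullet> d)) - L / 2 * t\<^sup>2 * (norm d)\<^sup>2"
      for t
    have "s 0 \<ge> s 1"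
    proof (rule DERIV_nonpos_imp_nonincreasing[of 0 1 s])
      fix t :: real assume t: "0 \<le> t"
      have "(s has_real_derivative \<sigma> * (d \<bullet> grad F (y + t *\<^sub>R d) - grad F y \<bullet> d)
          - L * t * (norm d)\<^sup>2) (at t)"
        unfolding s_def by (rule derivative_eq_intros D refl)+ (simp add: algebra_simps)
      moreover have "\<sigma> * (d \<bullet> grad F (y + t *\<^sub>R d) - grad F y \<bullet> d) \<le> L * t * (norm d)\<^sup>2"
        using slope[OF t] that
        by (metis abs_ge_self abs_mult mult_1 order_trans)
      ultimately show "\<exists>D. (s has_real_derivative D) (at t) \<and> D \<le> 0"
        by force
    qed simp
    then show ?thesis
      by (simp add: s_def d_def algebra_simps)
  qed
  show ?thesis
    using main[of 1, simplified] main[of "-1", simplified]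
    unfolding bregman_def d_def[symmetric] by linarith
qed

lemma h_fun_GDERIV:
  assumes "\<phi> differentiable (at x)"
  shows "GDERIV (h_fun \<tau> \<phi>) x :> (1 / \<tau>) *\<^sub>R x - grad \<phi> x"
proof -
  define c where "c = 1 / (2 * \<tau>)"
  have c: "1 / \<tau> = 2 * c"
    by (simp add: c_def)
  have h: "h_fun \<tau> \<phi> = (\<lambda>x. c * (x \<bullet> x) - \<phi> x)"
    by (rule ext) (simp add: c_def h_fun_def inner_prod_def power2_norm_eq_inner)
  have [derivative_intros]: "(\<phi> has_derivative (\<lambda>h. h \<bullet> grad \<phi> x)) (at x)"
    using differentiable_has_grad[OF assms] by (simp add: gderiv_def)
  show ?thesis
    unfolding gderiv_def h c
    by (auto intro!: derivative_eq_intros simp: inner_diff_right inner_commute fun_eq_iff)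
qed

lemma grad_h_fun:
  "\<phi> differentiable (at x) \<Longrightarrow> grad (h_fun \<tau> \<phi>) x = (1 / \<tau>) *\<^sub>R x - grad \<phi> x"
  by (rule grad_eqI) (rule h_fun_GDERIV)

lemma bregman_h_fun:
  assumes "\<phi> differentiable (at y)"
  shows "bregman (h_fun \<tau> \<phi>) x y = 1 / (2 * \<tau>) * (norm (x - y))\<^sup>2 - bregman \<phi> x y"
proof -
  have h: "h_fun \<tau> \<phi> z = 1 / (2 * \<tau>) * (z \<bullet> z) - \<phi> z" for z
    by (simp add: h_fun_def inner_prod_def power2_norm_eq_inner)
  define c where "c = 1 / (2 * \<tau>)"
  have c: "1 / (2 * \<tau>) = c" "1 / \<tau> = 2 * c"
    by (simp_all add: c_def)
  show ?thesis
    unfolding bregman_def grad_h_fun[OF assms] h c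
    by (simp add: power2_norm_eq_inner inner_diff_left inner_diff_right inner_commute
        algebra_simps)
qed

section \<open>Proximal maps of closed proper convex functions\<close>

lemma subdifferential_imp_effective_domain:
  assumes "closed_proper_convex \<psi>" "w \<in> subdifferential \<psi> x"
  shows "x \<in> effective_domain \<psi>"
proof -
  obtain y where "\<psi> y < \<infinity>"
    using assms(1) by (auto simp: closed_proper_convex_def effective_domain_def)
  moreover have "\<psi> x + ereal (w \<bullet> (y - x)) \<le> \<psi> y"
    using assms(2) by (simp add: subdifferential_def)
  ultimately show ?thesis
    by (cases "\<psi> x") (auto simp: effective_domain_def)
qed

lemma finite_on_effective_domain:
  assumes "closed_proper_convex \<psi>" "x \<in> effective_domain \<psi>"
  obtains r where "\<psi> x = ereal r"
  using assms by (cases "\<psi> x") (auto simp: closed_proper_convex_def effective_domain_def)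

lemma subdifferential_monotone:
  assumes \<psi>: "closed_proper_convex \<psi>"
    and w: "w \<in> subdifferential \<psi> x" and w': "w' \<in> subdifferential \<psi> x'"
  shows "(w - w') \<bullet> (x - x') \<ge> 0"
proof -
  obtain r r' where r: "\<psi> x = ereal r" "\<psi> x' = ereal r'"
    using finite_on_effective_domain[OF \<psi>] subdifferential_imp_effective_domain[OF \<psi>] w w'
    by metis
  have "\<psi> x + ereal (w \<bullet> (x' - x)) \<le> \<psi> x'" "\<psi> x' + ereal (w' \<bullet> (x - x')) \<le> \<psi> x"
    using w w' by (auto simp: subdifferential_def)
  then show ?thesis
    by (simp add: r algebra_simps)
qed

text \<open>A point just below the graph is separated from the closed convex epigraph; the separating
  hyperplane cannot be vertical because the point lies below a point of the graph.\<close>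

lemma closed_proper_convex_affine_minorant:
  fixes \<psi> :: "'a::euclidean_space \<Rightarrow> ereal"
  assumes \<psi>: "closed_proper_convex \<psi>"
  obtains a c where "\<And>x r. (x, r) \<in> epi \<psi> \<Longrightarrow> a \<bullet> x + c \<le> r"
proof -
  obtain x0 where "x0 \<in> effective_domain \<psi>"
    using \<psi> by (auto simp: closed_proper_convex_def)
  then obtain r0 where r0: "\<psi> x0 = ereal r0"
    using finite_on_effective_domain[OF \<psi>] by blast
  have "(x0, r0 - 1) \<notin> epi \<psi>"
    by (simp add: epi_def r0)
  then obtain A b where A: "A \<bullet> (x0, r0 - 1) < b" "\<forall>s \<in> epi \<psi>. A \<bullet> s > b"
    using separating_hyperplane_closed_point[of "epi \<psi>" "(x0, r0 - 1)"] \<psi>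
    by (auto simp: closed_proper_convex_def)
  obtain \<alpha> \<beta> where AB: "A = (\<alpha>, \<beta>)"
    by fastforce
  have "(x0, r0) \<in> epi \<psi>"
    by (simp add: epi_def r0)
  then have "\<alpha> \<bullet> x0 + \<beta> * (r0 - 1) < b" "b < \<alpha> \<bullet> x0 + \<beta> * r0"
    using A by (auto simp: AB inner_prod_def)
  then have "\<beta> > 0"
    by (simp add: algebra_simps)
  show ?thesis
  proof
    fix x r assume "(x, r) \<in> epi \<psi>"
    then have "b < \<alpha> \<bullet> x + \<beta> * r"
      using A(2) by (force simp: AB inner_prod_def)
    then show "(- (1 / \<beta>) *\<^sub>R \<alpha>) \<bullet> x + b / \<beta> \<le> r"
      using \<open>\<beta> > 0\<close> by (simp add: field_simps)
  qed
qed

text \<open>The resolvent point is the minimiser of \<open>\<psi> + norm (\<cdot> - y)\<^sup>2 / 2\<close>. Minimising over the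
  epigraph instead of over the space turns lower semicontinuity into closedness; the affine
  minorant makes the sublevel sets bounded. The subgradient inequality is the first-order
  condition along segments from the minimiser.\<close>

lemma closed_proper_convex_resolvent_exists:
  fixes \<psi> :: "'a::euclidean_space \<Rightarrow> ereal"
  assumes \<psi>: "closed_proper_convex \<psi>"
  obtains p where "y - p \<in> subdifferential \<psi> p"
proof -
  obtain a c where minorant: "\<And>x r. (x, r) \<in> epi \<psi> \<Longrightarrow> a \<bullet> x + c \<le> r"
    using closed_proper_convex_affine_minorant[OF \<psi>] by blast
  obtain x0 where "x0 \<in> effective_domain \<psi>"
    using \<psi> by (auto simp: closed_proper_convex_def)
  then obtain r0 where r0: "\<psi> x0 = ereal r0"
    using finite_on_effective_domain[OF \<psi>] by blast
  define Q where "Q = (\<lambda>s::'a \<times> real. snd s + (norm (fst s - y))\<^sup>2 / 2)"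
  define C where "C = Q (x0, r0)"
  define S where "S = epi \<psi> \<inter> {s. Q s \<le> C}"
  have contQ: "continuous_on X Q" for X
    unfolding Q_def by (intro continuous_intros) auto
  have "closed S"
    unfolding S_def using \<psi>
    by (intro closed_Int closed_Collect_le contQ continuous_on_const)
       (auto simp: closed_proper_convex_def)
  \<comment> \<open>\<open>(norm (x - y) - (norm a + 1))\<^sup>2 \<ge> 0\<close> lets the quadratic term beat the linear minorant and
    leaves a bound linear in \<open>norm (x - y)\<close>.\<close>
  define R where "R = C - c - a \<bullet> y + (norm a + 1)\<^sup>2 / 2"
  have "S \<subseteq> cball y R \<times> {a \<bullet> y + c - norm a * R .. C}"
  proof clarify
    fix x r assume "(x, r) \<in> S"
    then have xr: "a \<bullet> x + c \<le> r" "r + (norm (x - y))\<^sup>2 / 2 \<le> C"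
      using minorant by (auto simp: S_def Q_def)
    have ax: "a \<bullet> x \<ge> a \<bullet> y - norm a * norm (x - y)"
      using Cauchy_Schwarz_ineq2[of a "x - y"] by (simp add: inner_diff_right)
    have "(norm (x - y) - (norm a + 1))\<^sup>2 \<ge> 0"
      by simp
    then have "norm (x - y) \<le> (norm (x - y))\<^sup>2 / 2 - norm a * norm (x - y) + (norm a + 1)\<^sup>2 / 2"
      by (simp add: power2_eq_square field_simps)
    then have n: "norm (x - y) \<le> R"
      using xr ax by (simp add: R_def)
    then have "norm a * norm (x - y) \<le> norm a * R"
      by (intro mult_left_mono) auto
    then have "a \<bullet> y + c - norm a * R \<le> r"
      using xr(1) ax by linarith
    moreover have "r \<le> C"
      using xr(2) by (smt (verit) divide_nonneg_nonneg zero_le_power2)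
    ultimately show "x \<in> cball y R \<and> r \<in> {a \<bullet> y + c - norm a * R .. C}"
      using n by (simp add: dist_norm norm_minus_commute)
  qed
  then have "bounded S"
    by (rule bounded_subset[rotated]) (intro bounded_Times bounded_cball bounded_closed_interval)
  with \<open>closed S\<close> have "compact S"
    by (simp add: compact_eq_bounded_closed)
  moreover have S0: "(x0, r0) \<in> S"
    by (simp add: S_def C_def epi_def r0)
  ultimately obtain s where s: "s \<in> S" "\<And>s'. s' \<in> S \<Longrightarrow> Q s \<le> Q s'"
    using continuous_attains_inf[of S Q, OF _ _ contQ] by blast
  obtain p r where pr: "s = (p, r)"
    by fastforce
  have min: "Q (p, r) \<le> Q s'" if "s' \<in> epi \<psi>" for s'
  proof (cases "Q s' \<le> C")
    case False
    then show ?thesis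
      using s(2)[OF S0] by (simp add: pr C_def)
  qed (use s(2)[of s'] that in \<open>simp add: S_def pr\<close>)
  have pr_epi: "(p, r) \<in> epi \<psi>"
    using s(1) by (simp add: S_def pr)
  then have "p \<in> effective_domain \<psi>"
    by (auto simp: epi_def effective_domain_def)
  then obtain \<rho> where \<rho>: "\<psi> p = ereal \<rho>"
    using finite_on_effective_domain[OF \<psi>] by blast
  have "r = \<rho>"
    using min[of "(p, \<rho>)"] pr_epi by (simp add: Q_def epi_def \<rho>)
  have "\<psi> p + ereal ((y - p) \<bullet> (z - p)) \<le> \<psi> z" for z
  proof (cases "z \<in> effective_domain \<psi>")
    case False
    then show ?thesis
      by (simp add: effective_domain_def)
  next
    case True
    then obtain q where q: "\<psi> z = ereal q"
      using finite_on_effective_domain[OF \<psi>] by blast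
    define A where "A = q - r - (y - p) \<bullet> (z - p)"
    define B where "B = (norm (z - p))\<^sup>2 / 2"
    have segment: "0 \<le> A + t * B" if t: "0 < t" "t \<le> 1" for t
    proof -
      have "(1 - t) *\<^sub>R (p, r) + t *\<^sub>R (z, q) \<in> epi \<psi>"
        using \<psi> pr_epi t q unfolding closed_proper_convex_def
        by (intro convexD) (auto simp: epi_def)
      then have "(p + t *\<^sub>R (z - p), r + t * (q - r)) \<in> epi \<psi>"
        by (simp add: algebra_simps)
      from min[OF this]
      have "(norm (p - y))\<^sup>2 / 2 \<le> t * (q - r) + (norm ((p - y) + t *\<^sub>R (z - p)))\<^sup>2 / 2"
        by (simp add: Q_def algebra_simps)
      also have "(norm ((p - y) + t *\<^sub>R (z - p)))\<^sup>2
          = (norm (p - y))\<^sup>2 + 2 * t * ((p - y) \<bullet> (z - p)) + t\<^sup>2 * (norm (z - p))\<^sup>2"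
        unfolding power2_norm_eq_inner
        by (simp add: inner_add_left inner_add_right inner_commute power2_eq_square)
      also have "(p - y) \<bullet> (z - p) = - ((y - p) \<bullet> (z - p))"
        by (simp add: inner_diff_left)
      finally have "0 \<le> t * (A + t * B)"
        by (simp add: A_def B_def power2_eq_square add_divide_distrib
            diff_divide_distrib algebra_simps del: inner_diff_left inner_diff_right)
      then show ?thesis
        using t by (simp add: zero_le_mult_iff)
    qed
    have "A \<ge> 0"
    proof (rule ccontr)
      assume "\<not> A \<ge> 0"
      moreover have "B \<ge> 0"
        by (simp add: B_def)
      ultimately have "A < 0" "B - A > 0"
        by auto
      \<comment> \<open>A parameter in \<open>{0<..1}\<close> small enough that \<open>t * B < - A\<close>, whatever the size of \<open>B\<close>.\<close>
      then have "0 \<le> A + - A / (B - A) * B"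
        using \<open>B \<ge> 0\<close> by (intro segment) (auto simp: field_simps)
      also have "\<dots> = - (A * A / (B - A))"
        using \<open>B - A > 0\<close> by (simp add: field_simps)
      finally have "A * A / (B - A) \<le> 0"
        by simp
      moreover have "A * A / (B - A) > 0"
        using \<open>A < 0\<close> \<open>B - A > 0\<close> by (intro divide_pos_pos mult_neg_neg)
      ultimately show False
        by simp
    qed
    then show ?thesis
      by (simp add: A_def q \<rho> \<open>r = \<rho>\<close>)
  qed
  then have "y - p \<in> subdifferential \<psi> p"
    by (simp add: subdifferential_def)
  then show ?thesis
    using that by blast
qed

lemma prox_in_resolvent:
  fixes \<psi> :: "'a::euclidean_space \<Rightarrow> ereal"
  assumes \<psi>: "closed_proper_convex \<psi>"
  shows "y - prox \<psi> y \<in> subdifferential \<psi> (prox \<psi> y)"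
proof -
  have image_iff: "y \<in> (\<lambda>w. p + w) ` subdifferential \<psi> p \<longleftrightarrow> y - p \<in> subdifferential \<psi> p" for p
    by (auto simp: image_iff algebra_simps) (metis add.commute diff_add_cancel)
  have "\<exists>!p. y - p \<in> subdifferential \<psi> p"
  proof (rule ex_ex1I)
    show "\<exists>p. y - p \<in> subdifferential \<psi> p"
      using closed_proper_convex_resolvent_exists[OF \<psi>] by metis
  next
    fix p q assume "y - p \<in> subdifferential \<psi> p" "y - q \<in> subdifferential \<psi> q"
    from subdifferential_monotone[OF \<psi> this] have "(p - q) \<bullet> (p - q) \<le> 0"
      by (simp add: inner_diff_left)
    then show "p = q"
      by (metis eq_iff_diff_eq_0 inner_eq_zero_iff inner_ge_zero order_antisym)
  qed
  then show ?thesis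
    unfolding prox_def image_iff by (rule theI')
qed

lemma prox_nonexpansive:
  fixes \<psi> :: "'a::euclidean_space \<Rightarrow> ereal"
  assumes \<psi>: "closed_proper_convex \<psi>"
  shows "norm (prox \<psi> y - prox \<psi> z) \<le> norm (y - z)"
proof -
  define e where "e = prox \<psi> y - prox \<psi> z"
  have "((y - prox \<psi> y) - (z - prox \<psi> z)) \<bullet> e \<ge> 0"
    unfolding e_def
    by (intro subdifferential_monotone[OF \<psi>] prox_in_resolvent[OF \<psi>])
  then have "(norm e)\<^sup>2 \<le> (y - z) \<bullet> e"
    by (simp add: e_def power2_norm_eq_inner inner_diff_left)
  also have "\<dots> \<le> norm (y - z) * norm e"
    by (rule norm_cauchy_schwarz)
  finally show ?thesis
    unfolding e_def[symmetric] by (cases "norm e = 0") (auto simp: power2_eq_square)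
qed

lemma closed_proper_convex_scale:
  fixes \<psi> :: "'a::euclidean_space \<Rightarrow> ereal"
  assumes \<psi>: "closed_proper_convex \<psi>" and "t > 0"
  shows "closed_proper_convex (\<lambda>x. ereal t * \<psi> x)"
proof -
  have epi: "epi (\<lambda>x. ereal t * \<psi> x) = (\<lambda>s. (fst s, snd s / t)) -` epi \<psi>"
  proof -
    have "ereal t * \<psi> x \<le> ereal r \<longleftrightarrow> \<psi> x \<le> ereal (r / t)" for x r
      using \<open>t > 0\<close> by (cases "\<psi> x") (auto simp: field_simps)
    then show ?thesis
      by (auto simp: epi_def)
  qed
  have "closed (epi (\<lambda>x. ereal t * \<psi> x))"
    unfolding epi using \<psi> \<open>t > 0\<close>
    by (intro closed_vimage continuous_intros) (auto simp: closed_proper_convex_def)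
  moreover have "convex (epi (\<lambda>x. ereal t * \<psi> x))"
    unfolding epi using \<psi>
    by (intro convex_linear_vimage linearI)
       (auto simp: closed_proper_convex_def add_divide_distrib)
  moreover have "ereal t * \<psi> x \<noteq> -\<infinity>" for x
    using \<psi> \<open>t > 0\<close> by (cases "\<psi> x") (auto simp: closed_proper_convex_def)
  moreover obtain x where "x \<in> effective_domain \<psi>"
    using \<psi> by (auto simp: closed_proper_convex_def)
  then have "x \<in> effective_domain (\<lambda>x. ereal t * \<psi> x)"
    using \<open>t > 0\<close> by (cases "\<psi> x") (auto simp: effective_domain_def)
  ultimately show ?thesis
    by (auto simp: closed_proper_convex_def)
qed

lemma subdifferential_scale:
  fixes \<psi> :: "'a::euclidean_space \<Rightarrow> ereal"
  assumes "t > 0" "w \<in> subdifferential (\<lambda>x. ereal t * \<psi> x) x"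
  shows "(1 / t) *\<^sub>R w \<in> subdifferential \<psi> x"
proof -
  have "\<psi> x + ereal ((1 / t) *\<^sub>R w \<bullet> (y - x)) \<le> \<psi> y" for y
  proof -
    have "ereal t * \<psi> x + ereal (w \<bullet> (y - x)) \<le> ereal t * \<psi> y"
      using assms(2) by (simp add: subdifferential_def)
    then show ?thesis
      using \<open>t > 0\<close> by (cases "\<psi> x"; cases "\<psi> y") (auto simp: field_simps)
  qed
  then show ?thesis
    by (simp add: subdifferential_def)
qed

lemma prox_scale_in_resolvent:
  fixes \<psi> :: "'a::euclidean_space \<Rightarrow> ereal" and y p :: 'a
  assumes "closed_proper_convex \<psi>" "t > 0"
  defines "p \<equiv> prox (\<lambda>x. ereal t * \<psi> x) y"
  shows "(1 / t) *\<^sub>R (y - p) \<in> subdifferential \<psi> p"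
  unfolding p_def using assms(1,2)
  by (intro subdifferential_scale prox_in_resolvent closed_proper_convex_scale)

section \<open>One step of the semi-anchored method\<close>

locale samgda_setup =
  fixes f :: "'u::euclidean_space \<Rightarrow> ereal"
    and g :: "'v::euclidean_space \<Rightarrow> ereal"
    and \<phi> :: "'u \<times> 'v \<Rightarrow> real"
    and Luu Luv Lvu Lvv L \<Omega> \<tau> :: real
  assumes smooth: "composite_smoothness f g \<phi> Luu Luv Lvu Lvv"
    and L_pos: "L > 0" and grad_lipschitz: "L-lipschitz_on UNIV (grad \<phi>)"
    and bounded: "bounded_domain f g \<Omega>"
    and \<tau>_pos: "\<tau> > 0" and inverse_\<tau>: "1 / \<tau> > L + Lvv"
begin

abbreviation h where "h \<equiv> h_fun \<tau> \<phi>"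
abbreviation M where "M \<equiv> saddle_operator f g \<phi>"

lemma f_closed: "closed_proper_convex f" and g_closed: "closed_proper_convex g"
  and Lvv_pos: "Lvv > 0"
  using smooth by (auto simp: composite_smoothness_def)

lemma \<phi>_differentiable: "\<phi> differentiable (at x)"
  using smooth unfolding composite_smoothness_def continuously_differentiable_def by blast

lemma grad_v_lipschitz: "norm (grad_v \<phi> (u, v) - grad_v \<phi> (u, v')) \<le> Lvv * norm (v - v')"
proof -
  have "norm (grad_v \<phi> (u, v) - grad_v \<phi> (u, v')) \<le> Lvu * norm (u - u) + Lvv * norm (v - v')"
    using smooth unfolding composite_smoothness_def by blast
  then show ?thesis
    by simp
qed

lemma bregman_h_nonneg: "bregman h x y \<ge> 0"
proof -
  have "bregman \<phi> x y \<le> L / 2 * (norm (x - y))\<^sup>2"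
    using descent_lemma[OF \<phi>_differentiable grad_lipschitz, of x y] by linarith
  also have "\<dots> \<le> 1 / (2 * \<tau>) * (norm (x - y))\<^sup>2"
    using inverse_\<tau> Lvv_pos by (intro mult_right_mono) auto
  finally show ?thesis
    by (simp add: bregman_h_fun[OF \<phi>_differentiable])
qed

lemma bregman_h_upper: "bregman h x y \<le> (1 / \<tau> + L) / 2 * (norm (x - y))\<^sup>2"
  using descent_lemma[OF \<phi>_differentiable grad_lipschitz, of x y]
  by (simp add: bregman_h_fun[OF \<phi>_differentiable] algebra_simps add_divide_distrib)

lemma grad_h_lipschitz: "norm (grad h x - grad h y) \<le> (1 / \<tau> + L) * norm (x - y)"
proof -
  have "grad h x - grad h y = (1 / \<tau>) *\<^sub>R (x - y) - (grad \<phi> x - grad \<phi> y)"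
    by (simp add: grad_h_fun[OF \<phi>_differentiable] algebra_simps)
  also have "norm \<dots> \<le> norm ((1 / \<tau>) *\<^sub>R (x - y)) + norm (grad \<phi> x - grad \<phi> y)"
    by (rule norm_triangle_ineq4)
  also have "\<dots> \<le> (1 / \<tau>) * norm (x - y) + L * norm (x - y)"
    using lipschitz_onD[OF grad_lipschitz, of x y] \<tau>_pos by (simp add: dist_norm)
  finally show ?thesis
    by (simp add: algebra_simps)
qed

text \<open>For a zero \<open>x\<^sub>*\<close> with the strong Minty property, a Bregman proximal point step from \<open>x\<close>
  to \<open>p\<close> contracts \<open>D\<^sub>h(x\<^sub>*, \<cdot>)\<close>: the three-point identity produces \<open>\<mu> (norm (p - x\<^sub>*))\<^sup>2\<close>, which
  the smoothness of \<open>h\<close> turns back into a multiple of \<open>D\<^sub>h(x\<^sub>*, p)\<close>.\<close>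

lemma bregman_proximal_point_contraction:
  assumes xs: "xs \<in> strong_MVI_solutions \<mu> M" and "\<mu> \<ge> 0"
    and p: "grad h x - grad h p \<in> M p"
  shows "(1 + 2 * \<tau> * \<mu> / (1 + \<tau> * L)) * bregman h xs p \<le> bregman h xs x"
proof -
  have "2 * \<tau> * \<mu> / (1 + \<tau> * L) * bregman h xs p
      \<le> 2 * \<tau> * \<mu> / (1 + \<tau> * L) * ((1 / \<tau> + L) / 2 * (norm (xs - p))\<^sup>2)"
    using \<tau>_pos L_pos \<open>\<mu> \<ge> 0\<close> by (intro mult_left_mono bregman_h_upper) auto
  also have "2 * \<tau> * \<mu> / (1 + \<tau> * L) * ((1 / \<tau> + L) / 2 * (norm (xs - p))\<^sup>2)
      = \<mu> * (norm (p - xs))\<^sup>2"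
  proof -
    have "1 + \<tau> * L > 0"
      using \<tau>_pos L_pos by (simp add: add_pos_pos)
    moreover have "1 / \<tau> + L = (1 + \<tau> * L) / \<tau>"
      using \<tau>_pos by (simp add: field_simps)
    ultimately show ?thesis
      using \<tau>_pos by (simp add: norm_minus_commute)
  qed
  also have "\<dots> \<le> (p - xs) \<bullet> (grad h x - grad h p)"
    using xs p unfolding strong_MVI_solutions_def gra_def by blast
  also have "\<dots> = bregman h xs x - bregman h xs p - bregman h p x"
    by (subst bregman_three_point[of h xs x p]) (simp add: inner_commute)
  also have "\<dots> \<le> bregman h xs x - bregman h xs p"
    using bregman_h_nonneg by simp
  finally show ?thesis
    by (simp add: algebra_simps)
qed

text \<open>The inner map composes a nonexpansive proximal map with a map of Lipschitz constant
  \<open>2 \<eta> Lvv (1 + 1)\<close>.\<close>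

lemma samgda_inner_contraction:
  "norm (samgda_inner g \<phi> Lvv \<tau> x u w - samgda_inner g \<phi> Lvv \<tau> x u w')
    \<le> 4 * Lvv / (1 / \<tau> + 2 * Lvv) * norm (w - w')"
proof -
  define \<eta> where "\<eta> = \<tau> / (1 + 2 * Lvv * \<tau>)"
  have pos: "1 + 2 * Lvv * \<tau> > 0"
    using Lvv_pos \<tau>_pos by (simp add: add_pos_pos)
  then have "\<eta> > 0"
    using \<tau>_pos by (simp add: \<eta>_def)
  define G where "G = grad_v \<phi> (u, w) - grad_v \<phi> (u, w')"
  have "norm (samgda_inner g \<phi> Lvv \<tau> x u w - samgda_inner g \<phi> Lvv \<tau> x u w')
      \<le> norm ((2 * \<eta> * Lvv) *\<^sub>R ((w - w') + (1 / Lvv) *\<^sub>R G))"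
    unfolding samgda_inner_def Let_def \<eta>_def[symmetric]
    by (rule order_trans[OF prox_nonexpansive[OF closed_proper_convex_scale[OF g_closed \<open>\<eta> > 0\<close>]]])
       (simp add: G_def algebra_simps)
  also have "\<dots> \<le> (2 * \<eta> * Lvv) * (norm (w - w') + norm ((1 / Lvv) *\<^sub>R G))"
    using \<open>\<eta> > 0\<close> Lvv_pos unfolding norm_scaleR
    by (simp add: mult_left_mono norm_triangle_le)
  also have "norm ((1 / Lvv) *\<^sub>R G) \<le> norm (w - w')"
    using grad_v_lipschitz[of u w w'] Lvv_pos unfolding G_def norm_scaleR
    by (simp add: divide_le_eq mult.commute)
  finally have "norm (samgda_inner g \<phi> Lvv \<tau> x u w - samgda_inner g \<phi> Lvv \<tau> x u w')
      \<le> (2 * \<eta> * Lvv) * (norm (w - w') + norm (w - w'))"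
    using \<open>\<eta> > 0\<close> Lvv_pos by (simp add: mult_left_mono)
  also have "\<dots> = 4 * Lvv * \<eta> * norm (w - w')"
    by simp
  also have "\<eta> = 1 / (1 / \<tau> + 2 * Lvv)"
    using \<tau>_pos pos by (simp add: \<eta>_def field_simps)
  finally show ?thesis
    by simp
qed

lemma samgda_inner_in_domain: "samgda_inner g \<phi> Lvv \<tau> x u w \<in> effective_domain g"
proof -
  have "\<tau> / (1 + 2 * Lvv * \<tau>) > 0"
    using Lvv_pos \<tau>_pos by (simp add: add_pos_pos)
  from prox_scale_in_resolvent[OF g_closed this] show ?thesis
    unfolding samgda_inner_def Let_def
    by (rule subdifferential_imp_effective_domain[OF g_closed])
qed

lemma funpow_samgda_inner_in_domain:
  "J \<ge> 1 \<Longrightarrow> (samgda_inner g \<phi> Lvv \<tau> x u ^^ J) w \<in> effective_domain g"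
  by (cases J) (auto simp: samgda_inner_in_domain)

text \<open>The anchoring term \<open>2 \<eta> Lvv v\<close> is absorbed by the prox parameter because
  \<open>1 - 2 \<eta> Lvv = \<eta> / \<tau>\<close>.\<close>

lemma samgda_inner_fixed_point:
  assumes "samgda_inner g \<phi> Lvv \<tau> x u v = v"
  shows "(1 / \<tau>) *\<^sub>R (snd x - v) - grad_v \<phi> x + 2 *\<^sub>R grad_v \<phi> (u, v) \<in> subdifferential g v"
proof -
  define \<eta> where "\<eta> = \<tau> / (1 + 2 * Lvv * \<tau>)"
  have pos: "1 + 2 * Lvv * \<tau> > 0"
    using Lvv_pos \<tau>_pos by (simp add: add_pos_pos)
  then have "\<eta> > 0"
    using \<tau>_pos by (simp add: \<eta>_def)
  define y where "y = (\<eta> / \<tau>) *\<^sub>R (snd x - \<tau> *\<^sub>R grad_v \<phi> x)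
         + (2 * \<eta> * Lvv) *\<^sub>R (v + (1 / Lvv) *\<^sub>R grad_v \<phi> (u, v))"
  have v: "prox (\<lambda>v. ereal \<eta> * g v) y = v"
    using assms unfolding samgda_inner_def Let_def y_def \<eta>_def .
  have "(1 / \<eta>) *\<^sub>R (y - v) \<in> subdifferential g v"
    using prox_scale_in_resolvent[OF g_closed \<open>\<eta> > 0\<close>, of y] by (simp add: v)
  moreover have "(1 / \<eta>) *\<^sub>R (y - v)
      = (1 / \<tau>) *\<^sub>R snd x - grad_v \<phi> x + 2 *\<^sub>R grad_v \<phi> (u, v) + (2 * Lvv - 1 / \<eta>) *\<^sub>R v"
    using \<open>\<eta> > 0\<close> \<tau>_pos Lvv_pos by (simp add: y_def algebra_simps)
  moreover have "2 * Lvv - 1 / \<eta> = - (1 / \<tau>)"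
    using \<tau>_pos by (simp add: \<eta>_def field_simps)
  ultimately have "(1 / \<tau>) *\<^sub>R snd x - grad_v \<phi> x + 2 *\<^sub>R grad_v \<phi> (u, v) + (- (1 / \<tau>)) *\<^sub>R v
      \<in> subdifferential g v"
    by metis
  then show ?thesis
    by (simp add: algebra_simps)
qed

definition primal_step :: "'u \<times> 'v \<Rightarrow> 'u" where
  "primal_step x = prox (\<lambda>u. ereal \<tau> * f u) (fst x - \<tau> *\<^sub>R grad_u \<phi> x)"

lemma primal_step_subgradient:
  "(1 / \<tau>) *\<^sub>R (fst x - primal_step x) - grad_u \<phi> x \<in> subdifferential f (primal_step x)"
  using prox_scale_in_resolvent[OF f_closed \<tau>_pos, of "fst x - \<tau> *\<^sub>R grad_u \<phi> x"] \<tau>_pos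
  by (simp add: primal_step_def algebra_simps)

lemma primal_step_in_domain: "primal_step x \<in> effective_domain f"
  by (rule subdifferential_imp_effective_domain[OF f_closed primal_step_subgradient])

lemma samgda_step_eq:
  "samgda_step f g \<phi> Lvv \<tau> J x
    = (primal_step x, (samgda_inner g \<phi> Lvv \<tau> x (primal_step x) ^^ J) (snd x))"
  by (simp add: samgda_step_def primal_step_def Let_def)

text \<open>Solving the inner problem exactly amounts to the step \<open>(\<nabla>h + M)\<^sup>-\<^sup>1 \<nabla>h\<close> of the Bregman
  proximal point method.\<close>

lemma exact_step_is_bregman_proximal_point:
  assumes "samgda_inner g \<phi> Lvv \<tau> x (primal_step x) v = v"
  shows "grad h x - grad h (primal_step x, v) \<in> M (primal_step x, v)"
proof -
  define p where "p = (primal_step x, v)"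
  have h: "grad h z = ((1 / \<tau>) *\<^sub>R fst z - grad_u \<phi> z, (1 / \<tau>) *\<^sub>R snd z - grad_v \<phi> z)" for z
    by (simp add: grad_h_fun[OF \<phi>_differentiable] grad_u_eq_fst_grad[OF \<phi>_differentiable]
        grad_v_eq_snd_grad[OF \<phi>_differentiable] prod_eq_iff)
  have "grad h x - grad h p
      = (grad_u \<phi> p + ((1 / \<tau>) *\<^sub>R (fst x - primal_step x) - grad_u \<phi> x),
         - grad_v \<phi> p + ((1 / \<tau>) *\<^sub>R (snd x - v) - grad_v \<phi> x + 2 *\<^sub>R grad_v \<phi> p))"
    by (simp add: h p_def algebra_simps scaleR_2)
  also have "\<dots> \<in> M p"
    unfolding saddle_operator_def
    using primal_step_subgradient[of x] samgda_inner_fixed_point[OF assms]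
    by (auto simp: p_def)
  finally show ?thesis
    by (simp add: p_def)
qed

lemma MVI_solution_in_domain:
  assumes "xs \<in> strong_MVI_solutions \<mu> M"
  shows "xs \<in> effective_domain f \<times> effective_domain g"
proof -
  have "0 \<in> M xs"
    using assms by (simp add: strong_MVI_solutions_def zeros_def)
  then obtain a b where "a \<in> subdifferential f (fst xs)" "b \<in> subdifferential g (snd xs)"
    by (auto simp: saddle_operator_def zero_prod_def)
  then show ?thesis
    using subdifferential_imp_effective_domain f_closed g_closed by (metis mem_Times_iff)
qed

lemma norm_diff_le_diameter:
  assumes "x \<in> effective_domain f \<times> effective_domain g"
    and "y \<in> effective_domain f \<times> effective_domain g"
  shows "norm (x - y) \<le> \<Omega>"
  using bounded assms unfolding bounded_domain_def by blast

text \<open>Only the iterates after the first inner step are known to lie in the domain of \<open>g\<close>, so only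
  \<open>J - 1\<close> contractions start from an error of at most \<open>\<Omega>\<close>. The contraction factor
  is at most \<open>1 - 2 c \<le> exp (- 2 c)\<close>, twice the claimed rate in the exponent, which makes up for
  the lost round because \<open>2 (J - 1) \<ge> J\<close>.\<close>

lemma inner_loop_error:
  fixes c :: real
  defines "c \<equiv> (1 / \<tau> - 2 * Lvv) / (2 * (1 / \<tau> + 2 * Lvv))"
  assumes "c > 0" "J \<ge> 2" and v: "samgda_inner g \<phi> Lvv \<tau> x (primal_step x) v = v"
  shows "norm ((samgda_inner g \<phi> Lvv \<tau> x (primal_step x) ^^ J) w - v) \<le> \<Omega> * exp (- (c * real J))"
proof -
  let ?F = "samgda_inner g \<phi> Lvv \<tau> x (primal_step x)"
  have pos: "1 / \<tau> + 2 * Lvv > 0"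
    using \<tau>_pos Lvv_pos by (simp add: add_pos_pos)
  have factor: "4 * Lvv / (1 / \<tau> + 2 * Lvv) = 1 - 2 * c"
  proof -
    have "2 * c = (1 / \<tau> - 2 * Lvv) / (1 / \<tau> + 2 * Lvv)"
      unfolding c_def by (simp only: times_divide_eq_right mult_divide_mult_cancel_left_if) simp
    also have "\<dots> = 1 - 4 * Lvv / (1 / \<tau> + 2 * Lvv)"
      using pos by (simp add: divide_eq_eq diff_divide_eq_iff)
    finally show ?thesis
      by simp
  qed
  have domains: "norm (?F w - v) \<le> \<Omega>"
    using norm_diff_le_diameter[of "(primal_step x, ?F w)" "(primal_step x, v)"]
      samgda_inner_in_domain[of x "primal_step x" w] samgda_inner_in_domain[of x "primal_step x" v]
      primal_step_in_domain[of x]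
    by (simp add: v norm_Pair)
  have iter: "norm ((?F ^^ Suc j) w - v) \<le> \<Omega> * exp (- 2 * c) ^ j" for j
  proof (induction j)
    case (Suc j)
    have "norm ((?F ^^ Suc (Suc j)) w - v) = norm (?F ((?F ^^ Suc j) w) - ?F v)"
      by (simp add: v)
    also have "\<dots> \<le> (1 - 2 * c) * norm ((?F ^^ Suc j) w - v)"
      using samgda_inner_contraction unfolding factor by blast
    also have "\<dots> \<le> exp (- 2 * c) * norm ((?F ^^ Suc j) w - v)"
      using exp_ge_add_one_self[of "- 2 * c"] by (intro mult_right_mono) auto
    also have "\<dots> \<le> exp (- 2 * c) * (\<Omega> * exp (- 2 * c) ^ j)"
      by (intro mult_left_mono Suc.IH) simp
    finally show ?case
      by (simp add: ac_simps)
  qed (use domains in simp)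
  obtain j where j: "J = Suc j" "j \<ge> 1"
    using \<open>J \<ge> 2\<close> by (cases J) auto
  have "norm ((?F ^^ J) w - v) \<le> \<Omega> * exp (- 2 * c) ^ j"
    using iter j by metis
  also have "exp (- 2 * c) ^ j = exp (- 2 * c * real j)"
    by (simp add: exp_of_nat_mult[symmetric] mult.commute)
  also have "\<dots> \<le> exp (- (c * real J))"
    using \<open>c > 0\<close> j by simp
  finally show ?thesis
    using norm_ge_zero[of "?F w - v"] domains by (smt (verit) mult_left_mono)
qed

text \<open>When the exponential is at least \<open>1 / 3\<close>, the diameter of the domain alone bounds \<open>D\<^sub>h\<close> by the
  error term. Otherwise \<open>c > 0\<close> and \<open>J \<ge> 2\<close>, the exact step exists by Banach's fixed point theorem,
  and the error of the inner loop is transferred to \<open>D\<^sub>h\<close> by the three-point identity.\<close>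

lemma samgda_step_inexact_contraction:
  fixes c :: real
  defines "c \<equiv> (1 / \<tau> - 2 * Lvv) / (2 * (1 / \<tau> + 2 * Lvv))"
  assumes xs: "xs \<in> strong_MVI_solutions \<mu> M" and "\<mu> \<ge> 0" and "J \<ge> 1"
  shows "bregman h xs (samgda_step f g \<phi> Lvv \<tau> J x)
    \<le> bregman h xs x / (1 + 2 * \<tau> * \<mu> / (1 + \<tau> * L))
      + 3 * \<Omega>\<^sup>2 * (1 / \<tau> + L) / 2 * exp (- (c * real J))"
proof -
  define \<theta> where "\<theta> = 1 + 2 * \<tau> * \<mu> / (1 + \<tau> * L)"
  define K where "K = 1 / \<tau> + L"
  define z where "z = samgda_step f g \<phi> Lvv \<tau> J x"
  define \<epsilon> where "\<epsilon> = exp (- (c * real J))"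
  have "\<theta> > 0"
    using \<tau>_pos L_pos \<open>\<mu> \<ge> 0\<close> by (simp add: \<theta>_def add_pos_nonneg)
  have "K > 0"
    using \<tau>_pos L_pos by (simp add: K_def add_pos_pos)
  have "\<epsilon> > 0"
    by (simp add: \<epsilon>_def)
  have xs_dom: "xs \<in> effective_domain f \<times> effective_domain g"
    by (rule MVI_solution_in_domain[OF xs])
  have z_dom: "z \<in> effective_domain f \<times> effective_domain g"
    using funpow_samgda_inner_in_domain[OF \<open>J \<ge> 1\<close>] primal_step_in_domain
    by (simp add: z_def samgda_step_eq)
  have "\<Omega> \<ge> 0"
    using norm_diff_le_diameter[OF xs_dom xs_dom] by simp
  have "bregman h xs z \<le> bregman h xs x / \<theta> + 3 * \<Omega>\<^sup>2 * K / 2 * \<epsilon>"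
  proof (cases "3 * \<epsilon> \<ge> 1")
    case True
    have "bregman h xs z \<le> K / 2 * (norm (xs - z))\<^sup>2"
      unfolding K_def by (rule bregman_h_upper)
    also have "\<dots> \<le> K / 2 * \<Omega>\<^sup>2"
      using norm_diff_le_diameter[OF xs_dom z_dom] \<open>K > 0\<close>
      by (intro mult_left_mono power_mono) auto
    also have "\<dots> \<le> K / 2 * \<Omega>\<^sup>2 * (3 * \<epsilon>)"
      using mult_left_mono[OF True, of "K / 2 * \<Omega>\<^sup>2"] \<open>K > 0\<close> by simp
    also have "\<dots> \<le> bregman h xs x / \<theta> + K / 2 * \<Omega>\<^sup>2 * (3 * \<epsilon>)"
      using bregman_h_nonneg[of xs x] \<open>\<theta> > 0\<close> by simp
    finally show ?thesis
      by (simp add: ac_simps)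
  next
    case False
    have c_half: "c < 1 / 2"
      using \<tau>_pos Lvv_pos by (simp add: c_def divide_less_eq add_pos_pos)
    have cJ: "c * real J > 1 / 2"
    proof (rule ccontr)
      assume "\<not> c * real J > 1 / 2"
      then have "1 / 2 \<le> \<epsilon>"
        using exp_ge_add_one_self[of "- (c * real J)"] by (simp add: \<epsilon>_def)
      then show False
        using False by simp
    qed
    then have "c > 0"
      by (smt (verit) mult_nonneg_nonneg mult_nonpos_nonneg of_nat_0_le_iff divide_pos_pos)
    moreover have "J \<ge> 2"
      using cJ c_half \<open>J \<ge> 1\<close> by (cases "J = 1") auto
    moreover obtain v where v: "samgda_inner g \<phi> Lvv \<tau> x (primal_step x) v = v"
    proof -
      have "1 / \<tau> > 2 * Lvv"
      proof -
        have "2 * (1 / \<tau> + 2 * Lvv) > 0"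
          using \<tau>_pos Lvv_pos by (simp add: add_pos_pos)
        then have "1 / \<tau> - 2 * Lvv > 0"
          using \<open>c > 0\<close> unfolding c_def by (metis zero_less_divide_iff less_asym)
        then show ?thesis
          by simp
      qed
      then have "\<exists>!v. samgda_inner g \<phi> Lvv \<tau> x (primal_step x) v = v"
        using samgda_inner_contraction \<tau>_pos Lvv_pos
        by (intro banach_fix_type[of "4 * Lvv / (1 / \<tau> + 2 * Lvv)"])
           (auto simp: dist_norm divide_less_eq add_pos_pos)
      then show ?thesis
        using that by blast
    qed
    ultimately have loop: "norm ((samgda_inner g \<phi> Lvv \<tau> x (primal_step x) ^^ J) (snd x) - v) \<le> \<Omega> * \<epsilon>"
      unfolding c_def \<epsilon>_def by (intro inner_loop_error)
    define p where "p = (primal_step x, v)"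
    have p_dom: "p \<in> effective_domain f \<times> effective_domain g"
      using samgda_inner_in_domain[of x "primal_step x" v] primal_step_in_domain
      by (simp add: p_def v)
    have pz: "norm (p - z) \<le> \<Omega> * \<epsilon>"
      using loop by (simp add: p_def z_def samgda_step_eq norm_Pair norm_minus_commute)
    have "bregman h xs z = bregman h xs p + bregman h p z + (grad h z - grad h p) \<bullet> (p - xs)"
      by (rule bregman_three_point)
    also have "\<dots> \<le> bregman h xs x / \<theta> + K / 2 * \<Omega>\<^sup>2 * \<epsilon> + K * \<Omega>\<^sup>2 * \<epsilon>"
    proof (intro add_mono)
      have "\<theta> * bregman h xs p \<le> bregman h xs x"
        unfolding \<theta>_def p_def
        by (rule bregman_proximal_point_contraction[OF xs \<open>\<mu> \<ge> 0\<close>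
              exact_step_is_bregman_proximal_point[OF v]])
      then show "bregman h xs p \<le> bregman h xs x / \<theta>"
        using \<open>\<theta> > 0\<close> by (simp add: pos_le_divide_eq mult.commute)
    next
      have "bregman h p z \<le> K / 2 * (norm (p - z))\<^sup>2"
        unfolding K_def by (rule bregman_h_upper)
      also have "(norm (p - z))\<^sup>2 \<le> \<Omega> * (\<Omega> * \<epsilon>)"
        unfolding power2_eq_square
        using norm_diff_le_diameter[OF p_dom z_dom] pz \<open>\<Omega> \<ge> 0\<close>
        by (intro mult_mono) auto
      finally show "bregman h p z \<le> K / 2 * \<Omega>\<^sup>2 * \<epsilon>"
        using \<open>K > 0\<close> by (simp add: power2_eq_square mult_left_mono ac_simps)
    next
      have "(grad h z - grad h p) \<bullet> (p - xs) \<le> norm (grad h z - grad h p) * norm (p - xs)"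
        by (rule norm_cauchy_schwarz)
      also have "\<dots> \<le> (K * (\<Omega> * \<epsilon>)) * \<Omega>"
      proof (intro mult_mono)
        have "norm (grad h z - grad h p) \<le> K * norm (z - p)"
          unfolding K_def by (rule grad_h_lipschitz)
        also have "\<dots> \<le> K * (\<Omega> * \<epsilon>)"
          using pz \<open>K > 0\<close> by (simp add: norm_minus_commute)
        finally show "norm (grad h z - grad h p) \<le> K * (\<Omega> * \<epsilon>)" .
      qed (use norm_diff_le_diameter[OF p_dom xs_dom] \<open>K > 0\<close> \<open>\<Omega> \<ge> 0\<close> \<open>\<epsilon> > 0\<close> in auto)
      finally show "(grad h z - grad h p) \<bullet> (p - xs) \<le> K * \<Omega>\<^sup>2 * \<epsilon>"
        by (simp add: power2_eq_square ac_simps)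
    qed
    finally show ?thesis
      by (simp add: field_simps)
  qed
  then show ?thesis
    by (simp add: \<theta>_def K_def z_def \<epsilon>_def)
qed

end

section \<open>Convergence rate\<close>

lemma inexact_contraction_unrolled:
  fixes a :: "nat \<Rightarrow> real"
  assumes "\<theta> > 0" and step: "\<And>n. a (Suc n) \<le> a n / \<theta> + E"
  shows "a k \<le> \<theta> powi (- int k) * a 0 + (\<Sum>i = 1..k. \<theta> powi (- int i + 1) * E)"
proof (induction k)
  case (Suc k)
  have shift: "\<theta> powi m / \<theta> = \<theta> powi (m - 1)" for m :: int
    using \<open>\<theta> > 0\<close> by (simp add: power_int_diff)
  have "a (Suc k) \<le> (\<theta> powi (- int k) * a 0 + (\<Sum>i = 1..k. \<theta> powi (- int i + 1) * E)) / \<theta> + E"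
    using step[of k] Suc.IH \<open>\<theta> > 0\<close>
    by (meson add_right_mono divide_right_mono less_imp_le order_trans)
  also have "\<dots> = \<theta> powi (- int k) / \<theta> * a 0
      + (\<Sum>i = 1..k. \<theta> powi (- int i + 1) / \<theta> * E) + E"
    by (simp add: add_divide_distrib sum_divide_distrib)
  also have "\<dots> = \<theta> powi (- int (Suc k)) * a 0
      + (E + (\<Sum>i = 1..k. \<theta> powi (- int (Suc i) + 1) * E))"
    unfolding shift by (simp add: minus_diff_commute del: sum.cl_ivl_Suc)
  also have "E + (\<Sum>i = 1..k. \<theta> powi (- int (Suc i) + 1) * E)
      = (\<Sum>i = 1..Suc k. \<theta> powi (- int i + 1) * E)"
    by (subst sum.atLeast_Suc_atMost) (simp_all only: sum.shift_bounds_cl_Suc_ivl, simp_all)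
  finally show ?case .
qed simp

theorem theorem5p6:
  fixes f :: "'u::euclidean_space \<Rightarrow> ereal"
    and g :: "'v::euclidean_space \<Rightarrow> ereal"
    and \<phi> :: "'u \<times> 'v \<Rightarrow> real"
    and Luu Luv Lvu Lvv L \<Omega> \<mu> \<tau> :: real
    and J k :: nat
    and x0 xs :: "'u \<times> 'v"
  assumes "composite_smoothness f g \<phi> Luu Luv Lvu Lvv"
    and "L > 0" and "L-lipschitz_on UNIV (grad \<phi>)"
    and "\<Omega> \<ge> 0" and "bounded_domain f g \<Omega>"
    and "\<mu> \<ge> 0" and "strong_MVI \<mu> (saddle_operator f g \<phi>)"
    and "J \<ge> 1" and "k \<ge> 1"
    and "\<tau> \<in> {0 <..< 1 / (L + max Luu Lvv)}"
    and "xs \<in> strong_MVI_solutions \<mu> (saddle_operator f g \<phi>)"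
  shows "bregman (h_fun \<tau> \<phi>) xs (samgda f g \<phi> Lvv \<tau> J x0 k)
    \<le> (1 + 2 * \<tau> * \<mu> / (1 + \<tau> * L)) powi (- int k) * bregman (h_fun \<tau> \<phi>) xs x0
      + (\<Sum>i = 1..k. (1 + 2 * \<tau> * \<mu> / (1 + \<tau> * L)) powi (- int i + 1)
          * (3 * \<Omega>\<^sup>2 * (1 / \<tau> + L) / 2)
          * exp (- ((1 / \<tau> - 2 * Lvv) / (2 * (1 / \<tau> + 2 * Lvv)) * real J)))"
proof -
  have smooth: "Luu > 0" "Lvv > 0"
    using assms(1) by (auto simp: composite_smoothness_def)
  have \<tau>: "\<tau> > 0" "\<tau> < 1 / (L + max Luu Lvv)"
    using assms(10) by auto
  have "L + max Luu Lvv < 1 / \<tau>"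
    using \<tau> \<open>L > 0\<close> smooth by (simp add: field_simps less_max_iff_disj)
  then have "L + Lvv < 1 / \<tau>"
    by simp
  then interpret samgda_setup f g \<phi> Luu Luv Lvu Lvv L \<Omega> \<tau>
    using assms \<tau> by unfold_locales auto
  have "1 + 2 * \<tau> * \<mu> / (1 + \<tau> * L) > 0"
    using \<tau> \<open>L > 0\<close> \<open>\<mu> \<ge> 0\<close> by (simp add: add_pos_nonneg)
  from inexact_contraction_unrolled[OF this, where a = "\<lambda>n. bregman h xs (samgda f g \<phi> Lvv \<tau> J x0 n)",
      simplified samgda.simps, OF samgda_step_inexact_contraction[OF assms(11,6,8)], of k]
  show ?thesis
    by (simp only: mult.assoc)
qed

end
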